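(* Let $(X,d)$ be a metric space that is Polish, i.e. the topology induced by $d$ on $X$ is separable and completely metrizable ($d$ itself is not required to be complete). Then $(CL(X),\tau_{H_d})$ is completely metrizable.
   Context: For a metric space $(X,d)$, $CL(X)$ denotes the set of nonempty closed subsets of $X$. For $x\in X$ and $A\in CL(X)$, $d(x,A)=\inf\{d(x,a):a\in A\}$. The Hausdorff distance is $H_d(A_0,A_1)=\sup\{|d(x,A_0)-d(x,A_1)|:x\in X\}$ for $A_0,A_1\in CL(X)$. It is a metric on $CL(X)$ if $d$ is bounded, and in general a possibly infinite-valued distance; $\tau_{H_d}$ denotes the topology on $CL(X)$ it generates, i.e. the topology with base consisting of the sets $\{A\in CL(X):H_d(A_0,A)<\varepsilon\}$ for $A_0\in CL(X)$ and $\varepsilon>0$ (equivalently, the topology of the metric $H_{\min\{1,d\}}$). A topological space is completely metrizable if its topology is induced by a complete metric. *)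

theory Defs
  imports "HOL-Analysis.Analysis"
begin

context Metric_space
begin

definition CL :: "'a set set"
  where "CL = {A. A \<noteq> {} \<and> closedin mtopology A}"

definition setdist_pt :: "'a \<Rightarrow> 'a set \<Rightarrow> real"
  where "setdist_pt x A = (INF a\<in>A. d x a)"

text \<open>The Hausdorff distance may be infinite, since \<open>d\<close> is not assumed to be bounded.\<close>

definition Hausdorff_dist :: "'a set \<Rightarrow> 'a set \<Rightarrow> ennreal"
  where "Hausdorff_dist A B = (SUP x\<in>M. ennreal \<bar>setdist_pt x A - setdist_pt x B\<bar>)"

definition Hausdorff_ball :: "'a set \<Rightarrow> real \<Rightarrow> 'a set set"
  where "Hausdorff_ball A \<epsilon> = {B \<in> CL. Hausdorff_dist A B < ennreal \<epsilon>}"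

text \<open>The balls are used as a subbase here; \<open>openin_Hausdorff_topology\<close> below shows that they
  form a base.\<close>

definition Hausdorff_topology :: "'a set topology"
  where "Hausdorff_topology = topology_generated_by {Hausdorff_ball A \<epsilon> |A \<epsilon>. A \<in> CL \<and> \<epsilon> > 0}"

lemma Hausdorff_dist_refl [simp]: "Hausdorff_dist A A = 0"
proof -
  have "Hausdorff_dist A A \<le> 0"
    unfolding Hausdorff_dist_def by (intro SUP_least) simp
  then show ?thesis by simp
qed

lemma Hausdorff_dist_triangle:
  "Hausdorff_dist A C \<le> Hausdorff_dist A B + Hausdorff_dist B C"
  unfolding Hausdorff_dist_def
proof (rule SUP_least)
  fix x assume x: "x \<in> M"
  have "ennreal \<bar>setdist_pt x A - setdist_pt x C\<bar>
      \<le> ennreal (\<bar>setdist_pt x A - setdist_pt x B\<bar> + \<bar>setdist_pt x B - setdist_pt x C\<bar>)"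
    by (intro ennreal_leI) linarith
  also have "\<dots> = ennreal \<bar>setdist_pt x A - setdist_pt x B\<bar> + ennreal \<bar>setdist_pt x B - setdist_pt x C\<bar>"
    by (simp add: ennreal_plus)
  also have "\<dots> \<le> (SUP x\<in>M. ennreal \<bar>setdist_pt x A - setdist_pt x B\<bar>)
      + (SUP x\<in>M. ennreal \<bar>setdist_pt x B - setdist_pt x C\<bar>)"
    by (intro add_mono SUP_upper x)
  finally show "ennreal \<bar>setdist_pt x A - setdist_pt x C\<bar> \<le> \<dots>" .
qed

lemma Hausdorff_ball_subball:
  assumes "B \<in> Hausdorff_ball A \<epsilon>"
  shows "\<exists>\<delta>>0. Hausdorff_ball B \<delta> \<subseteq> Hausdorff_ball A \<epsilon>"
proof -
  have lt: "Hausdorff_dist A B < ennreal \<epsilon>"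
    using assms by (simp add: Hausdorff_ball_def)
  then obtain r where r: "Hausdorff_dist A B = ennreal r" "r \<ge> 0"
    by (cases "Hausdorff_dist A B" rule: ennreal_cases) auto
  have re: "r < \<epsilon>"
    using lt r by (simp add: ennreal_less_iff)
  have "C \<in> Hausdorff_ball A \<epsilon>" if C: "C \<in> Hausdorff_ball B (\<epsilon> - r)" for C
  proof -
    have lt2: "Hausdorff_dist B C < ennreal (\<epsilon> - r)"
      using C by (simp add: Hausdorff_ball_def)
    have "Hausdorff_dist A C \<le> ennreal r + Hausdorff_dist B C"
      using Hausdorff_dist_triangle[of A C B] r by simp
    also have "\<dots> < ennreal r + ennreal (\<epsilon> - r)"
      using lt2 by (simp add: ennreal_add_left_cancel_less)
    also have "\<dots> = ennreal \<epsilon>"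
      using r re by (simp flip: ennreal_plus)
    finally show ?thesis
      using C by (simp add: Hausdorff_ball_def)
  qed
  then show ?thesis
    using re by (intro exI[of _ "\<epsilon> - r"]) auto
qed

lemma openin_Hausdorff_topology:
  "openin Hausdorff_topology U \<longleftrightarrow>
    U \<subseteq> CL \<and> (\<forall>A\<in>U. \<exists>\<epsilon>>0. Hausdorff_ball A \<epsilon> \<subseteq> U)" (is "_ \<longleftrightarrow> ?R U")
proof
  assume "openin Hausdorff_topology U"
  then have "generate_topology_on {Hausdorff_ball A \<epsilon> |A \<epsilon>. A \<in> CL \<and> \<epsilon> > 0} U"
    by (simp add: Hausdorff_topology_def openin_topology_generated_by_iff)
  then show "?R U"
  proof induction
    case (Int a b)
    show ?case
    proof (intro conjI ballI)
      show "a \<inter> b \<subseteq> CL" using Int by auto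
    next
      fix A assume "A \<in> a \<inter> b"
      then obtain e f where ef: "e > 0" "f > 0" "Hausdorff_ball A e \<subseteq> a" "Hausdorff_ball A f \<subseteq> b"
        using Int by blast
      have "ennreal (min e f) \<le> ennreal e" "ennreal (min e f) \<le> ennreal f"
        by (auto intro: ennreal_leI)
      then have "Hausdorff_ball A (min e f) \<subseteq> Hausdorff_ball A e \<inter> Hausdorff_ball A f"
        by (auto simp: Hausdorff_ball_def intro: less_le_trans)
      then show "\<exists>\<epsilon>>0. Hausdorff_ball A \<epsilon> \<subseteq> a \<inter> b"
        using ef by (intro exI[of _ "min e f"]) auto
    qed
  next
    case (UN K)
    then show ?case by (meson Sup_least Union_iff subset_iff)
  next
    case (Basis s)
    then obtain A \<epsilon> where s: "s = Hausdorff_ball A \<epsilon>" by blast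
    show ?case
      using Hausdorff_ball_subball[of _ A \<epsilon>] unfolding s by (auto simp: Hausdorff_ball_def)
  qed auto
next
  assume R: "?R U"
  have "openin Hausdorff_topology (\<Union>{Hausdorff_ball A \<epsilon> |A \<epsilon>. A \<in> CL \<and> \<epsilon> > 0 \<and> Hausdorff_ball A \<epsilon> \<subseteq> U})"
    unfolding Hausdorff_topology_def
    by (intro openin_Union) (auto intro!: topology_generated_by_Basis)
  moreover have "\<Union>{Hausdorff_ball A \<epsilon> |A \<epsilon>. A \<in> CL \<and> \<epsilon> > 0 \<and> Hausdorff_ball A \<epsilon> \<subseteq> U} = U"
  proof (intro equalityI subsetI)
    fix A assume A: "A \<in> U"
    then obtain \<epsilon> where e: "\<epsilon> > 0" "Hausdorff_ball A \<epsilon> \<subseteq> U" using R by blast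
    have "A \<in> Hausdorff_ball A \<epsilon>"
      using A R e by (auto simp: Hausdorff_ball_def)
    then show "A \<in> \<Union>{Hausdorff_ball A \<epsilon> |A \<epsilon>. A \<in> CL \<and> \<epsilon> > 0 \<and> Hausdorff_ball A \<epsilon> \<subseteq> U}"
      using A R e by blast
  qed auto
  ultimately show "openin Hausdorff_topology U" by simp
qed

lemma topspace_Hausdorff_topology [simp]: "topspace Hausdorff_topology = CL"
proof
  show "topspace Hausdorff_topology \<subseteq> CL"
    using openin_Hausdorff_topology openin_topspace by blast
  have "openin Hausdorff_topology CL"
    by (auto simp: openin_Hausdorff_topology Hausdorff_ball_def intro: exI[of _ 1])
  then show "CL \<subseteq> topspace Hausdorff_topology" by (rule openin_subset)
qed

end

end

theory Submission
  imports Defs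
begin

text \<open>
  The hyperspace \<open>CL(X)\<close> is realised as a \<open>G\<^sub>\<delta>\<close> subset of a complete metric space, and a
  \<open>G\<^sub>\<delta>\<close> subset of a completely metrizable space is completely metrizable.

  Let \<open>Y\<close> be the metric completion of \<open>X\<close>. Truncating the Hausdorff distance at \<open>1\<close> gives a metric
  for the Hausdorff topology, and for the complete space \<open>Y\<close> this metric on \<open>CL(Y)\<close> is complete
  (\<open>mcomplete_capped_Hausdorff_dist\<close>). Taking closures in \<open>Y\<close> maps \<open>CL(X)\<close> into \<open>CL(Y)\<close>
  isometrically, because distance functions do not change when a set is replaced by its closure, and
  a supremum of continuous functions may be computed on the dense set \<open>X\<close>. The image consists of
  those \<open>B\<close> in \<open>CL(Y)\<close> in which the trace \<open>B \<inter> X\<close> is dense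
  (\<open>Hausdorff_topology_homeomorphic\<close>).

  It remains to see that this image is a \<open>G\<^sub>\<delta>\<close> (\<open>gdelta_in_Hausdorff_dense_trace\<close>). As \<open>X\<close> is
  completely metrizable, it is an intersection of open sets \<open>U\<^sub>n\<close> of \<open>Y\<close>. A closed subset \<open>B\<close> of
  \<open>Y\<close> is itself a Baire space, so \<open>B \<inter> X\<close> is dense in \<open>B\<close> as soon as every \<open>B \<inter> U\<^sub>n\<close> is. Density
  of \<open>B \<inter> U\<^sub>n\<close> can be tested on a countable base of \<open>Y\<close>, which is where separability enters: for
  every basic \<open>V\<close>, either \<open>B\<close> misses \<open>V\<close> or it meets \<open>V \<inter> U\<^sub>n\<close>. Meeting an open set is an
  open condition on \<open>B\<close> and missing one is a closed condition, hence also a \<open>G\<^sub>\<delta>\<close> condition in the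
  metrizable space \<open>CL(Y)\<close>; so each of these countably many requirements describes a \<open>G\<^sub>\<delta>\<close> set.
\<close>

context Metric_space
begin

section \<open>Distance functions of closed sets\<close>

lemma setdist_pt_le: "a \<in> A \<Longrightarrow> setdist_pt x A \<le> d x a"
  unfolding setdist_pt_def by (rule cINF_lower) (auto intro: bdd_belowI2[of _ 0])

lemma setdist_pt_nonneg: "A \<noteq> {} \<Longrightarrow> 0 \<le> setdist_pt x A"
  unfolding setdist_pt_def by (rule cINF_greatest) auto

lemma setdist_pt_approx:
  assumes "A \<noteq> {}" "e > 0"
  obtains a where "a \<in> A" "d x a < setdist_pt x A + e"
proof -
  have "(INF a\<in>A. d x a) < setdist_pt x A + e"
    using assms(2) by (simp add: setdist_pt_def)
  then show thesis
    using that assms(1) by (subst (asm) cINF_less_iff) (auto intro: bdd_belowI2[of _ 0])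
qed

lemma setdist_pt_triangle:
  assumes "x \<in> M" "y \<in> M" "A \<subseteq> M" "A \<noteq> {}"
  shows "setdist_pt x A \<le> d x y + setdist_pt y A"
proof (rule field_le_epsilon)
  fix e :: real assume "e > 0"
  then obtain a where a: "a \<in> A" "d y a < setdist_pt y A + e"
    using setdist_pt_approx assms(4) by blast
  have "setdist_pt x A \<le> d x y + d y a"
    using setdist_pt_le[OF a(1), of x] triangle[of x y a] a(1) assms by force
  with a(2) show "setdist_pt x A \<le> d x y + setdist_pt y A + e" by simp
qed

lemma setdist_pt_Lipschitz:
  assumes "x \<in> M" "y \<in> M" "A \<subseteq> M" "A \<noteq> {}"
  shows "\<bar>setdist_pt x A - setdist_pt y A\<bar> \<le> d x y"
  using setdist_pt_triangle[of x y A] setdist_pt_triangle[of y x A] assms commute[of x y] by simp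

lemma CL_D: "A \<in> CL \<Longrightarrow> A \<noteq> {}" "A \<in> CL \<Longrightarrow> A \<subseteq> M" "A \<in> CL \<Longrightarrow> closedin mtopology A"
  using closedin_subset[of mtopology A] by (auto simp: CL_def)

lemma setdist_pt_eq_0_iff:
  assumes "A \<in> CL" "x \<in> M"
  shows "setdist_pt x A = 0 \<longleftrightarrow> x \<in> A"
proof
  assume 0: "setdist_pt x A = 0"
  have "\<exists>y\<in>A. y \<in> mball x r" if "r > 0" for r
    using setdist_pt_approx[of A r x] that CL_D[OF assms(1)] assms(2) 0 by auto
  then have "x \<in> mtopology closure_of A"
    using assms(2) by (auto simp: metric_closure_of)
  then show "x \<in> A"
    using CL_D(3)[OF assms(1)] by (metis closure_of_closedin)
next
  assume "x \<in> A"
  then show "setdist_pt x A = 0"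
    using setdist_pt_le[of x A x] setdist_pt_nonneg[of A x] assms(2) by auto
qed

lemma setdist_pt_closure_of:
  assumes "A \<subseteq> M" "A \<noteq> {}" "x \<in> M"
  shows "setdist_pt x (mtopology closure_of A) = setdist_pt x A"
proof (rule antisym)
  have sub: "A \<subseteq> mtopology closure_of A"
    using assms by (simp add: closure_of_subset)
  show "setdist_pt x (mtopology closure_of A) \<le> setdist_pt x A"
    unfolding setdist_pt_def[of x A]
    using assms sub by (intro cINF_greatest setdist_pt_le) auto
  show "setdist_pt x A \<le> setdist_pt x (mtopology closure_of A)"
    unfolding setdist_pt_def[of x "mtopology closure_of A"]
  proof (rule cINF_greatest)
    fix y assume y: "y \<in> mtopology closure_of A"
    show "setdist_pt x A \<le> d x y"
    proof (rule field_le_epsilon)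
      fix e :: real assume "e > 0"
      then obtain a where a: "a \<in> A" "a \<in> M" "y \<in> M" "d y a < e"
        using y by (auto simp: metric_closure_of)
      then show "setdist_pt x A \<le> d x y + e"
        using setdist_pt_le[OF a(1), of x] triangle[of x y a] assms by simp
    qed
  qed (use sub assms in auto)
qed

section \<open>A metric for the Hausdorff topology\<close>

lemma Hausdorff_dist_le_iff:
  "r \<ge> 0 \<Longrightarrow> Hausdorff_dist A B \<le> ennreal r \<longleftrightarrow>
    (\<forall>x\<in>M. \<bar>setdist_pt x A - setdist_pt x B\<bar> \<le> r)"
  unfolding Hausdorff_dist_def by (simp add: SUP_le_iff)

lemma Hausdorff_dist_commute: "Hausdorff_dist A B = Hausdorff_dist B A"
  unfolding Hausdorff_dist_def by (simp add: abs_minus_commute)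

definition capped_Hausdorff_dist :: "'a set \<Rightarrow> 'a set \<Rightarrow> real"
  where "capped_Hausdorff_dist A B = enn2real (min 1 (Hausdorff_dist A B))"

lemma ennreal_capped_Hausdorff_dist:
  "ennreal (capped_Hausdorff_dist A B) = min 1 (Hausdorff_dist A B)"
  unfolding capped_Hausdorff_dist_def by (rule ennreal_enn2real) (auto simp: min_less_iff_disj)

lemma capped_Hausdorff_dist_nonneg: "0 \<le> capped_Hausdorff_dist A B"
  by (simp add: capped_Hausdorff_dist_def)

lemma capped_Hausdorff_dist_less_iff:
  assumes "0 < r" "r \<le> 1"
  shows "capped_Hausdorff_dist A B < r \<longleftrightarrow> Hausdorff_dist A B < ennreal r"
proof -
  have "capped_Hausdorff_dist A B < r \<longleftrightarrow> min 1 (Hausdorff_dist A B) < ennreal r"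
    unfolding ennreal_capped_Hausdorff_dist[symmetric]
    using assms capped_Hausdorff_dist_nonneg by (simp add: ennreal_less_iff)
  also have "\<dots> \<longleftrightarrow> Hausdorff_dist A B < ennreal r"
    using assms(2) ennreal_leI[of r 1] by (auto simp: min_less_iff_disj)
  finally show ?thesis .
qed

lemma setdist_pt_diff_less:
  assumes "capped_Hausdorff_dist A B < r" "r \<le> 1" "x \<in> M"
  shows "\<bar>setdist_pt x A - setdist_pt x B\<bar> < r"
proof -
  have r: "0 < r"
    using assms(1) capped_Hausdorff_dist_nonneg[of A B] by linarith
  have "ennreal \<bar>setdist_pt x A - setdist_pt x B\<bar> \<le> Hausdorff_dist A B"
    unfolding Hausdorff_dist_def by (rule SUP_upper) fact
  also have "\<dots> < ennreal r"
    using assms r by (simp add: capped_Hausdorff_dist_less_iff)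
  finally show ?thesis by (simp add: ennreal_less_iff)
qed

lemma Metric_space_CL: "Metric_space CL capped_Hausdorff_dist"
proof
  show "0 \<le> capped_Hausdorff_dist A B" for A B
    by (rule capped_Hausdorff_dist_nonneg)
  show "capped_Hausdorff_dist A B = capped_Hausdorff_dist B A" for A B
    by (simp add: capped_Hausdorff_dist_def Hausdorff_dist_commute)
  show "capped_Hausdorff_dist A B = 0 \<longleftrightarrow> A = B" if AB: "A \<in> CL" "B \<in> CL" for A B
  proof
    assume 0: "capped_Hausdorff_dist A B = 0"
    have "\<bar>setdist_pt x A - setdist_pt x B\<bar> \<le> 0" if "x \<in> M" for x
    proof (rule field_le_epsilon)
      fix e :: real assume "e > 0"
      then show "\<bar>setdist_pt x A - setdist_pt x B\<bar> \<le> 0 + e"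
        using setdist_pt_diff_less[of A B "min e 1" x] 0 that by simp
    qed
    then have "x \<in> A \<longleftrightarrow> x \<in> B" if "x \<in> M" for x
      using setdist_pt_eq_0_iff[OF AB(1) that] setdist_pt_eq_0_iff[OF AB(2) that] that by force
    then show "A = B"
      using AB CL_D(2) by blast
  qed (simp add: capped_Hausdorff_dist_def)
  show "capped_Hausdorff_dist A C \<le> capped_Hausdorff_dist A B + capped_Hausdorff_dist B C" for A B C
  proof -
    have "min 1 (Hausdorff_dist A C) \<le> min 1 (Hausdorff_dist A B + Hausdorff_dist B C)"
      by (intro min.mono order.refl Hausdorff_dist_triangle)
    also have "\<dots> \<le> min 1 (Hausdorff_dist A B) + min 1 (Hausdorff_dist B C)"
      by (auto simp: min_def add_increasing add_increasing2)
    finally have "ennreal (capped_Hausdorff_dist A C)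
        \<le> ennreal (capped_Hausdorff_dist A B + capped_Hausdorff_dist B C)"
      by (simp add: ennreal_capped_Hausdorff_dist ennreal_plus capped_Hausdorff_dist_nonneg)
    then show ?thesis
      by (subst (asm) ennreal_le_iff) (simp_all add: capped_Hausdorff_dist_nonneg)
  qed
qed

lemma mtopology_capped_Hausdorff_dist:
  "Metric_space.mtopology CL capped_Hausdorff_dist = Hausdorff_topology"
proof -
  interpret H: Metric_space CL capped_Hausdorff_dist
    by (rule Metric_space_CL)
  have ball: "H.mball A r = Hausdorff_ball A r" if "A \<in> CL" "0 < r" "r \<le> 1" for A r
    using that by (auto simp: H.mball_def Hausdorff_ball_def capped_Hausdorff_dist_less_iff)
  have mono: "Hausdorff_ball A r \<subseteq> Hausdorff_ball A s" if "r \<le> s" for A r s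
    using ennreal_leI[OF that] by (auto simp: Hausdorff_ball_def)
  have iff: "(\<exists>r>0. H.mball A r \<subseteq> U) \<longleftrightarrow> (\<exists>r>0. Hausdorff_ball A r \<subseteq> U)"
    if A: "A \<in> CL" for A U
  proof
    assume "\<exists>r>0. H.mball A r \<subseteq> U"
    then obtain r where "r > 0" "H.mball A r \<subseteq> U" by blast
    then show "\<exists>r>0. Hausdorff_ball A r \<subseteq> U"
      using ball[OF A, of "min r 1"] H.mball_subset_concentric[of "min r 1" r A]
      by (intro exI[of _ "min r 1"]) auto
  next
    assume "\<exists>r>0. Hausdorff_ball A r \<subseteq> U"
    then obtain r where "r > 0" "Hausdorff_ball A r \<subseteq> U" by blast
    then show "\<exists>r>0. H.mball A r \<subseteq> U"
      using ball[OF A, of "min r 1"] mono[of "min r 1" r A]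
      by (intro exI[of _ "min r 1"]) auto
  qed
  show ?thesis
    unfolding topology_eq H.openin_mtopology openin_Hausdorff_topology
    using iff by blast
qed

lemma metrizable_Hausdorff_topology: "metrizable_space Hausdorff_topology"
  using Metric_space.metrizable_space_mtopology[OF Metric_space_CL]
  by (simp add: mtopology_capped_Hausdorff_dist)

text \<open>If \<open>A\<close> meets \<open>V\<close> in a point \<open>a\<close> with an \<open>r\<close>-ball inside \<open>V\<close>, then the distance functions
  of \<open>A\<close> and of any \<open>B\<close> with Hausdorff distance less than \<open>r\<close> from \<open>A\<close> differ at \<open>a\<close> by less than \<open>r\<close>,
  so \<open>B\<close> has a point in that ball.\<close>

lemma openin_Hausdorff_hit:
  assumes V: "openin mtopology V"
  shows "openin Hausdorff_topology {B \<in> CL. B \<inter> V \<noteq> {}}"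
  unfolding openin_Hausdorff_topology
proof (intro conjI ballI)
  fix A assume "A \<in> {B \<in> CL. B \<inter> V \<noteq> {}}"
  then obtain a where A: "A \<in> CL" and a: "a \<in> A" "a \<in> V" by blast
  then have aM: "a \<in> M" using CL_D by blast
  obtain r where r: "r > 0" "mball a r \<subseteq> V"
    using V a by (auto simp: openin_mtopology)
  define s where "s = min r 1"
  have s: "0 < s" "s \<le> 1" "s \<le> r" using r by (auto simp: s_def)
  have "B \<inter> V \<noteq> {}" if B: "B \<in> Hausdorff_ball A s" for B
  proof -
    have BCL: "B \<in> CL" using B by (simp add: Hausdorff_ball_def)
    have "\<bar>setdist_pt a A - setdist_pt a B\<bar> < s"
      using B s aM by (intro setdist_pt_diff_less)
        (auto simp: Hausdorff_ball_def capped_Hausdorff_dist_less_iff)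
    then have "setdist_pt a B < s"
      using setdist_pt_eq_0_iff[OF A aM] a by simp
    then obtain b where "b \<in> B" "d a b < s"
      using setdist_pt_approx[of B "s - setdist_pt a B" a] CL_D[OF BCL] by auto
    then have "b \<in> B" "b \<in> mball a r"
      using CL_D[OF BCL] aM s by auto
    then show ?thesis using r by blast
  qed
  then show "\<exists>\<epsilon>>0. Hausdorff_ball A \<epsilon> \<subseteq> {B \<in> CL. B \<inter> V \<noteq> {}}"
    using s by (intro exI[of _ s]) (auto simp: Hausdorff_ball_def)
qed auto

section \<open>Completeness of the hyperspace of a complete space\<close>

text \<open>For a Cauchy sequence of closed sets the distance functions converge uniformly to some \<open>g\<close>,
  and the candidate for the limit is the zero set \<open>A\<close> of \<open>g\<close>. What has to be shown is that \<open>g\<close> is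
  the distance function of \<open>A\<close>. That \<open>g\<close> is at most the distance to \<open>A\<close> follows because \<open>g\<close> is
  1-Lipschitz. The converse, the fact \<open>near\<close> below, uses completeness: starting from a point of an
  early set that nearly realises \<open>g x\<close>, one walks through ever later sets of the sequence with
  geometrically decreasing steps, and the limit of this walk is a zero of \<open>g\<close>.\<close>

lemma mcomplete_capped_Hausdorff_dist:
  assumes "mcomplete"
  shows "Metric_space.mcomplete CL capped_Hausdorff_dist"
proof -
  interpret H: Metric_space CL capped_Hausdorff_dist
    by (rule Metric_space_CL)
  show ?thesis
    unfolding H.mcomplete_def
  proof (intro allI impI)
    fix S assume "H.MCauchy S"
    then have S: "\<And>n. S n \<in> CL"
      and cau: "\<And>e. e > 0 \<Longrightarrow> \<exists>N. \<forall>m n. N \<le> m \<longrightarrow> N \<le> n \<longrightarrow> capped_Hausdorff_dist (S m) (S n) < e"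
      by (auto simp: H.MCauchy_def)
    have unif: "\<exists>N. \<forall>m\<ge>N. \<forall>n\<ge>N. \<forall>x\<in>M. \<bar>setdist_pt x (S m) - setdist_pt x (S n)\<bar> < e"
      if e: "e > 0" for e
    proof -
      obtain N where "\<forall>m n. N \<le> m \<longrightarrow> N \<le> n \<longrightarrow> capped_Hausdorff_dist (S m) (S n) < min e 1"
        using cau[of "min e 1"] e by force
      then have "\<forall>m\<ge>N. \<forall>n\<ge>N. \<forall>x\<in>M. \<bar>setdist_pt x (S m) - setdist_pt x (S n)\<bar> < min e 1"
        using setdist_pt_diff_less by (meson min.cobounded2)
      then show ?thesis by (meson min.strict_boundedE)
    qed
    define g where "g x = lim (\<lambda>n. setdist_pt x (S n))" for x
    have lim: "(\<lambda>n. setdist_pt x (S n)) \<longlonglongrightarrow> g x" if x: "x \<in> M" for x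
    proof -
      have "Cauchy (\<lambda>n. setdist_pt x (S n))"
        unfolding Cauchy_def dist_real_def using unif x by meson
      then show ?thesis
        unfolding g_def using Cauchy_convergent convergent_LIMSEQ_iff by blast
    qed
    have glim: "\<exists>N. \<forall>n\<ge>N. \<forall>x\<in>M. \<bar>setdist_pt x (S n) - g x\<bar> \<le> e" if e: "e > 0" for e
    proof -
      obtain N where N: "\<forall>m\<ge>N. \<forall>n\<ge>N. \<forall>x\<in>M. \<bar>setdist_pt x (S m) - setdist_pt x (S n)\<bar> < e"
        using unif[OF e] by blast
      have "\<bar>setdist_pt x (S n) - g x\<bar> \<le> e" if n: "n \<ge> N" and x: "x \<in> M" for n x
      proof (rule LIMSEQ_le_const2)
        show "(\<lambda>m. \<bar>setdist_pt x (S n) - setdist_pt x (S m)\<bar>) \<longlonglongrightarrow> \<bar>setdist_pt x (S n) - g x\<bar>"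
          by (intro tendsto_intros lim x)
        show "\<exists>N. \<forall>m\<ge>N. \<bar>setdist_pt x (S n) - setdist_pt x (S m)\<bar> \<le> e"
          using N n x by (intro exI[of _ N]) (auto intro: less_imp_le)
      qed
      then show ?thesis by blast
    qed
    have g_Lip: "\<bar>g x - g y\<bar> \<le> d x y" if "x \<in> M" "y \<in> M" for x y
    proof (rule LIMSEQ_le_const2)
      show "(\<lambda>m. \<bar>setdist_pt x (S m) - setdist_pt y (S m)\<bar>) \<longlonglongrightarrow> \<bar>g x - g y\<bar>"
        by (intro tendsto_intros lim that)
      show "\<exists>N. \<forall>m\<ge>N. \<bar>setdist_pt x (S m) - setdist_pt y (S m)\<bar> \<le> d x y"
        using setdist_pt_Lipschitz[OF that CL_D(2)[OF S] CL_D(1)[OF S]] by simp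
    qed
    have g_nonneg: "0 \<le> g x" if "x \<in> M" for x
      using setdist_pt_nonneg[OF CL_D(1)[OF S]] by (intro LIMSEQ_le_const[OF lim[OF that]]) simp

    define A where "A = {x \<in> M. g x = 0}"
    have near: "\<exists>a\<in>A. d x a \<le> g x + e" if x: "x \<in> M" and e: "e > 0" for x e
    proof -
      \<comment> \<open>Step \<open>k\<close> of the walk has length below \<open>3 * \<delta> k\<close>, so the walk has length at most \<open>6 * \<delta> 0\<close>;
        reaching its first point costs another \<open>2 * \<delta> 0\<close>, which is why \<open>e\<close> is divided by 8.\<close>
      define \<delta> where "\<delta> k = (e/8) * (1/2)^k" for k :: nat
      have \<delta>: "\<delta> k > 0" for k using e by (simp add: \<delta>_def)
      have "\<exists>N. \<forall>n\<ge>N. \<forall>x\<in>M. \<bar>setdist_pt x (S n) - g x\<bar> \<le> \<delta> k" for k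
        using glim[OF \<delta>] by blast
      then obtain N where N: "\<And>k n x. n \<ge> N k \<Longrightarrow> x \<in> M \<Longrightarrow> \<bar>setdist_pt x (S n) - g x\<bar> \<le> \<delta> k"
        by metis
      define T where "T k = S (N k)" for k
      have T: "T k \<in> CL" for k by (simp add: T_def S)
      have Tg: "\<bar>setdist_pt x (T k) - g x\<bar> \<le> \<delta> k" if "x \<in> M" for k x
        using N[of k "N k" x] that by (simp add: T_def)
      have step: "\<exists>b. b \<in> T (Suc k) \<and> d a b < 3 * \<delta> k" if a: "a \<in> T k" for a k
      proof -
        have aM: "a \<in> M" using a CL_D(2)[OF T] by blast
        have "setdist_pt a (T k) = 0"
          using setdist_pt_eq_0_iff[OF T aM] a by simp
        then have "setdist_pt a (T (Suc k)) \<le> \<delta> k + \<delta> (Suc k)"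
          using Tg[OF aM, of k] Tg[OF aM, of "Suc k"] by linarith
        moreover have "\<delta> (Suc k) = \<delta> k / 2" by (simp add: \<delta>_def)
        moreover obtain b where "b \<in> T (Suc k)" "d a b < setdist_pt a (T (Suc k)) + \<delta> k"
          using setdist_pt_approx[OF CL_D(1)[OF T[of "Suc k"]] \<delta>[of k], of a] by blast
        ultimately show ?thesis
          using \<delta>[of k] by (intro exI[of _ b] conjI) auto
      qed
      obtain a0 where a0: "a0 \<in> T 0" "d x a0 < setdist_pt x (T 0) + \<delta> 0"
        using setdist_pt_approx[OF CL_D(1)[OF T] \<delta>] by blast
      have "\<exists>f. \<forall>n. (f n \<in> T n \<and> (n = 0 \<longrightarrow> f n = a0)) \<and> d (f n) (f (Suc n)) < 3 * \<delta> n"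
        by (rule dependent_nat_choice) (use a0 step in auto)
      then obtain f where f: "\<And>n. f n \<in> T n" "f 0 = a0" "\<And>n. d (f n) (f (Suc n)) < 3 * \<delta> n"
        by blast
      have fM: "f n \<in> M" for n using f(1) CL_D(2)[OF T] by blast
      \<comment> \<open>The subtracted term makes the induction go through: it telescopes with the next step.\<close>
      have f_dist: "d (f n) (f (n + k)) \<le> 6 * \<delta> n - 6 * \<delta> (n + k)" for n k
      proof (induction k)
        case (Suc k)
        have "d (f n) (f (n + Suc k)) \<le> d (f n) (f (n + k)) + d (f (n + k)) (f (n + Suc k))"
          using triangle fM by simp
        moreover have "\<delta> (n + Suc k) = \<delta> (n + k) / 2" by (simp add: \<delta>_def)
        ultimately show ?case
          using Suc f(3)[of "n + k"] by simp
      qed (simp add: fM)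
      then have f_dist': "d (f n) (f (n + k)) \<le> 6 * \<delta> n" for n k
        using \<delta>[of "n + k"] by (smt (verit))
      have \<delta>_lim: "\<delta> \<longlonglongrightarrow> 0"
        unfolding \<delta>_def by (intro tendsto_mult_right_zero LIMSEQ_power_zero) simp
      have "MCauchy f"
        unfolding MCauchy_def
      proof (intro conjI allI impI)
        fix r :: real assume r: "r > 0"
        then obtain n where n: "\<delta> n < r / 12"
          using \<delta>_lim[THEN order_tendstoD(2), of "r/12"] by (auto simp: eventually_sequentially)
        have "d (f i) (f j) < r" if "n \<le> i" "n \<le> j" for i j
        proof -
          have "d (f n) (f i) \<le> 6 * \<delta> n" "d (f n) (f j) \<le> 6 * \<delta> n"
            using f_dist'[of n "i - n"] f_dist'[of n "j - n"] that by auto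
          then show ?thesis
            using triangle''[OF fM fM fM, of i j n] n by linarith
        qed
        then show "\<exists>N. \<forall>i j. N \<le> i \<longrightarrow> N \<le> j \<longrightarrow> d (f i) (f j) < r" by blast
      qed (use fM in auto)
      then obtain a where a: "limitin mtopology f a sequentially"
        using \<open>mcomplete\<close> by (auto simp: mcomplete_def)
      then have aM: "a \<in> M" by (rule limitin_mspace)
      have da: "(\<lambda>n. d (f n) a) \<longlonglongrightarrow> 0"
        using a fM by (simp add: limitin_metric_dist_null)
      have "(\<lambda>n. d (f n) a + \<delta> n) \<longlonglongrightarrow> 0 + 0"
        by (intro tendsto_add da \<delta>_lim)
      moreover have "g a \<le> d (f n) a + \<delta> n" for n
      proof -
        have "g (f n) \<le> \<delta> n"
          using Tg[OF fM, of n n] setdist_pt_eq_0_iff[OF T fM, of n n] f(1)[of n] by simp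
        then show ?thesis
          using g_Lip[OF fM aM, of n] by linarith
      qed
      ultimately have "g a \<le> 0"
        by (intro LIMSEQ_le_const[of "\<lambda>n. d (f n) a + \<delta> n"]) auto
      then have "a \<in> A"
        using g_nonneg[OF aM] aM by (simp add: A_def)
      moreover have "d a0 a \<le> 6 * \<delta> 0"
      proof (rule LIMSEQ_le_const)
        show "(\<lambda>n. 6 * \<delta> 0 + d (f n) a) \<longlonglongrightarrow> 6 * \<delta> 0"
          using tendsto_add[OF tendsto_const da] by simp
        show "\<exists>N. \<forall>n\<ge>N. d a0 a \<le> 6 * \<delta> 0 + d (f n) a"
          using f_dist'[of 0] triangle[OF fM fM aM, of 0] f(2) by (smt (verit) add_0)
      qed
      moreover have "setdist_pt x (T 0) \<le> g x + \<delta> 0"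
        using Tg[OF x, of 0] by linarith
      moreover have "d x a \<le> d x a0 + d a0 a"
        using triangle[OF x _ aM] fM[of 0] f(2) by simp
      moreover have "8 * \<delta> 0 = e" by (simp add: \<delta>_def)
      ultimately show ?thesis
        using a0(2) by (intro bexI[of _ a]) linarith+
    qed

    have "M \<noteq> {}" using CL_D(1,2)[OF S[of 0]] by auto
    then have "A \<noteq> {}" using near[of _ 1] by fastforce
    have "closedin mtopology A"
      unfolding closedin_metric
    proof (intro conjI allI impI)
      fix x assume x: "x \<in> M - A"
      then have gx: "g x > 0"
        using g_nonneg[of x] by (auto simp: A_def order_less_le)
      have "y \<notin> A" if "y \<in> mball x (g x)" for y
        using g_Lip[of x y] that by (auto simp: A_def)
      then show "\<exists>r>0. disjnt A (mball x r)"
        using gx by (intro exI[of _ "g x"]) (auto simp: disjnt_def)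
    qed (auto simp: A_def)
    with \<open>A \<noteq> {}\<close> have A: "A \<in> CL" by (simp add: CL_def)
    have g_eq: "setdist_pt x A = g x" if x: "x \<in> M" for x
    proof (rule antisym)
      show "setdist_pt x A \<le> g x"
        using near[OF x] setdist_pt_le by (meson field_le_epsilon order_trans)
      show "g x \<le> setdist_pt x A"
        unfolding setdist_pt_def
      proof (rule cINF_greatest[OF \<open>A \<noteq> {}\<close>])
        fix a assume "a \<in> A"
        then show "g x \<le> d x a"
          using g_Lip[OF x, of a] by (simp add: A_def)
      qed
    qed
    have "\<exists>N. \<forall>n\<ge>N. S n \<in> CL \<and> capped_Hausdorff_dist (S n) A < e" if e: "e > 0" for e
    proof -
      define r where "r = min e 1"
      have r: "0 < r" "r \<le> e" "r \<le> 1" using e by (auto simp: r_def)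
      obtain N where N: "\<forall>n\<ge>N. \<forall>x\<in>M. \<bar>setdist_pt x (S n) - g x\<bar> \<le> r/2"
        using glim[of "r/2"] r by auto
      have "capped_Hausdorff_dist (S n) A < e" if "n \<ge> N" for n
      proof -
        have "Hausdorff_dist (S n) A \<le> ennreal (r/2)"
          using N that r by (simp add: Hausdorff_dist_le_iff g_eq)
        also have "\<dots> < ennreal r"
          using r by (simp add: ennreal_less_iff)
        finally show ?thesis
          using r capped_Hausdorff_dist_less_iff[of r "S n" A] by simp
      qed
      then show ?thesis using S by blast
    qed
    then show "\<exists>A. limitin H.mtopology S A sequentially"
      using A by (auto simp: H.limit_metric_sequentially)
  qed
qed

section \<open>Closed sets with a dense trace on a given \<open>G\<^sub>\<delta>\<close> set\<close>

lemma second_countable_mtopology: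
  assumes "separable_space mtopology"
  shows "second_countable mtopology"
proof -
  obtain C where C: "countable C" "C \<subseteq> M" "mtopology closure_of C = M"
    using assms by (auto simp: separable_space_def)
  define \<B> where "\<B> = (\<lambda>(c, n). mball c (1 / real (Suc n))) ` (C \<times> UNIV)"
  have "\<exists>V\<in>\<B>. x \<in> V \<and> V \<subseteq> U" if U: "openin mtopology U" and x: "x \<in> U" for U x
  proof -
    have xM: "x \<in> M" using U x openin_subset by fastforce
    obtain r where r: "r > 0" "mball x r \<subseteq> U"
      using U x by (auto simp: openin_mtopology)
    obtain n where n: "1 / real (Suc n) < r / 2"
      using r(1) by (metis half_gt_zero nat_approx_posE)
    have "x \<in> mtopology closure_of C" "0 < 1 / real (Suc n)"
      using C(3) xM by auto
    then have "\<exists>c\<in>C. c \<in> mball x (1 / real (Suc n))"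
      unfolding metric_closure_of by blast
    then obtain c where c: "c \<in> C" "c \<in> M" "d x c < 1 / real (Suc n)"
      by auto
    have "mball c (1 / real (Suc n)) \<subseteq> mball x r"
      using c n xM commute[of x c] by (intro mball_subset) linarith+
    then show ?thesis
      using c r xM commute[of x c] by (intro bexI[of _ "mball c (1 / real (Suc n))"]) (auto simp: \<B>_def)
  qed
  moreover have "countable \<B>" using C(1) by (auto simp: \<B>_def)
  moreover have "\<forall>V\<in>\<B>. openin mtopology V" by (auto simp: \<B>_def)
  ultimately show ?thesis
    unfolding second_countable_def by blast
qed

text \<open>The sets \<open>E V n\<close> in the proof are the conditions ``\<open>B\<close> misses \<open>V\<close> or meets \<open>V \<inter> U n\<close>'', for \<open>V\<close>
  in a countable base. For fixed \<open>n\<close>, together they say that \<open>B \<inter> U n\<close> is dense in \<open>B\<close>; Baire's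
  theorem in the complete space \<open>B\<close> then lets one intersect over \<open>n\<close>.\<close>

lemma gdelta_in_Hausdorff_dense_trace:
  assumes "mcomplete" and sep: "separable_space mtopology" and G: "gdelta_in mtopology G"
  shows "gdelta_in Hausdorff_topology {B \<in> CL. B \<subseteq> mtopology closure_of (B \<inter> G)}"
proof -
  obtain U :: "nat \<Rightarrow> 'a set" where U: "\<And>n. openin mtopology (U n)" "G = \<Inter>(range U)"
    using G unfolding gdelta_in_descending by metis
  obtain \<B> where \<B>: "countable \<B>" "\<And>V. V \<in> \<B> \<Longrightarrow> openin mtopology V"
    "\<And>W x. openin mtopology W \<Longrightarrow> x \<in> W \<Longrightarrow> \<exists>V\<in>\<B>. x \<in> V \<and> V \<subseteq> W"
    using second_countable_mtopology[OF sep] unfolding second_countable_def by metis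
  define E where "E V n = {B \<in> CL. B \<inter> V = {}} \<union> {B \<in> CL. B \<inter> (V \<inter> U n) \<noteq> {}}" for V n
  have gdelta_E: "gdelta_in Hausdorff_topology (E V n)" if "V \<in> \<B>" for V n
    unfolding E_def
  proof (rule gdelta_in_Un)
    have "closedin Hausdorff_topology (topspace Hausdorff_topology - {B \<in> CL. B \<inter> V \<noteq> {}})"
      by (intro closedin_diff closedin_topspace openin_Hausdorff_hit \<B>(2)[OF that])
    also have "topspace Hausdorff_topology - {B \<in> CL. B \<inter> V \<noteq> {}} = {B \<in> CL. B \<inter> V = {}}"
      by auto
    finally have "closedin Hausdorff_topology {B \<in> CL. B \<inter> V = {}}" .
    then show "gdelta_in Hausdorff_topology {B \<in> CL. B \<inter> V = {}}"
      by (rule closed_imp_gdelta_in[OF metrizable_Hausdorff_topology])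
    show "gdelta_in Hausdorff_topology {B \<in> CL. B \<inter> (V \<inter> U n) \<noteq> {}}"
      by (intro open_imp_gdelta_in openin_Hausdorff_hit openin_Int \<B>(2)[OF that] U(1))
  qed
  have sub: "B \<subseteq> mtopology closure_of (B \<inter> G)" if B: "B \<in> CL" and E: "\<And>V n. V \<in> \<B> \<Longrightarrow> B \<in> E V n" for B
  proof -
    let ?X = "subtopology mtopology B"
    have BM: "B \<subseteq> M" and clo: "closedin mtopology B"
      using CL_D[OF B] by auto
    have "?X closure_of \<Inter>(range (\<lambda>n. B \<inter> U n)) = topspace ?X"
    proof (rule Baire_category)
      show "completely_metrizable_space ?X \<or> locally_compact_space ?X \<and> regular_space ?X"
        using completely_metrizable_space_closedin[OF completely_metrizable_space_mtopology[OF \<open>mcomplete\<close>] clo]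
        by blast
      fix T assume "T \<in> range (\<lambda>n. B \<inter> U n)"
      then obtain n where T: "T = B \<inter> U n" by blast
      have "openin ?X T"
        unfolding T by (rule openin_subtopology_Int2) (rule U)
      moreover have "x \<in> mtopology closure_of T" if x: "x \<in> B" for x
        unfolding in_closure_of
      proof (intro conjI allI impI)
        fix W assume W: "x \<in> W \<and> openin mtopology W"
        then obtain V where V: "V \<in> \<B>" "x \<in> V" "V \<subseteq> W"
          using \<B>(3) by blast
        then show "\<exists>y. y \<in> T \<and> y \<in> W"
          using E[OF V(1), of n] x unfolding T E_def by blast
      qed (use x BM in auto)
      then have "?X closure_of T = topspace ?X"
        using BM by (auto simp: closure_of_subtopology T)
      ultimately show "openin ?X T \<and> ?X closure_of T = topspace ?X" by blast
    qed auto
    moreover have "\<Inter>(range (\<lambda>n. B \<inter> U n)) = B \<inter> G"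
      using U(2) by auto
    ultimately show ?thesis
      using BM by (auto simp: closure_of_subtopology)
  qed
  have conv: "B \<in> E V n" if B: "B \<in> CL" "B \<subseteq> mtopology closure_of (B \<inter> G)" and V: "V \<in> \<B>" for B V n
  proof (cases "B \<inter> V = {}")
    case False
    then obtain x where "x \<in> V" "x \<in> mtopology closure_of (B \<inter> G)" using B by blast
    then obtain y where "y \<in> B \<inter> G" "y \<in> V"
      using \<B>(2)[OF V] by (meson in_closure_of)
    then show ?thesis
      using B(1) U(2) by (auto simp: E_def)
  qed (use B in \<open>auto simp: E_def\<close>)
  have eq: "{B \<in> CL. B \<subseteq> mtopology closure_of (B \<inter> G)} =
      \<Inter>(insert CL ((\<lambda>(V, n). E V n) ` (\<B> \<times> UNIV)))" (is "?L = \<Inter>?R")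
  proof (intro equalityI subsetI)
    fix B assume "B \<in> ?L"
    then show "B \<in> \<Inter>?R" using conv[of B] by blast
  next
    fix B assume B: "B \<in> \<Inter>?R"
    then have "B \<in> CL" "B \<in> E V n" if "V \<in> \<B>" for V n
      using that by blast+
    moreover have "B \<in> CL" using B by blast
    ultimately show "B \<in> ?L" using sub[of B] by blast
  qed
  \<comment> \<open>Inserting the whole space \<open>CL\<close> above keeps the family nonempty when the base is empty.\<close>
  show ?thesis
    unfolding eq
  proof (rule gdelta_in_Inter)
    have "gdelta_in Hausdorff_topology CL"
      using gdelta_in_topspace[of Hausdorff_topology] by simp
    then show "gdelta_in Hausdorff_topology S"
      if "S \<in> insert CL ((\<lambda>(V, n). E V n) ` (\<B> \<times> UNIV))" for S
      using that gdelta_E by auto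
  qed (use \<B>(1) in auto)
qed

end

section \<open>The hyperspace of a dense isometric subspace\<close>

locale dense_isometry = Metric_space12 +
  fixes f
  assumes maps_to: "f \<in> M1 \<rightarrow> M2"
    and isometry: "\<And>x y. x \<in> M1 \<Longrightarrow> y \<in> M1 \<Longrightarrow> d2 (f x) (f y) = d1 x y"
    and dense_image: "M2.mtopology closure_of (f ` M1) = M2"
begin

definition lift :: "'a set \<Rightarrow> 'b set"
  where "lift A = M2.mtopology closure_of (f ` A)"

lemma image_subset: "A \<subseteq> M1 \<Longrightarrow> f ` A \<subseteq> M2"
  using maps_to by (auto dest: Pi_mem)

lemma continuous_isometry: "continuous_map M1.mtopology M2.mtopology f"
  by (metis M1.metric_continuous_map M2.Metric_space_axioms isometry maps_to image_subset_iff_funcset)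

lemma lift_in_CL: "A \<in> M1.CL \<Longrightarrow> lift A \<in> M2.CL"
proof -
  assume A: "A \<in> M1.CL"
  have "f ` A \<subseteq> lift A"
    unfolding lift_def by (rule closure_of_subset) (simp add: image_subset M1.CL_D(2)[OF A])
  then have "lift A \<noteq> {}" using M1.CL_D(1)[OF A] by blast
  then show ?thesis by (simp add: M2.CL_def lift_def)
qed

lemma setdist_pt_lift:
  assumes "A \<in> M1.CL" "x \<in> M1"
  shows "M2.setdist_pt (f x) (lift A) = M1.setdist_pt x A"
proof -
  have A: "A \<subseteq> M1" "A \<noteq> {}" using M1.CL_D[OF assms(1)] by auto
  have "M2.setdist_pt (f x) (lift A) = M2.setdist_pt (f x) (f ` A)"
    unfolding lift_def using A image_subset[OF A(1)] assms(2) maps_to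
    by (intro M2.setdist_pt_closure_of) auto
  also have "\<dots> = M1.setdist_pt x A"
    unfolding M1.setdist_pt_def M2.setdist_pt_def image_image
    using A assms isometry by (intro INF_cong) auto
  finally show ?thesis .
qed

text \<open>The supremum defining the Hausdorff distance in the larger space runs over all of \<open>M2\<close>. It
  does not shrink when restricted to the dense image of \<open>f\<close>, as moving \<open>y\<close> by less than \<open>e / 2\<close> changes each of
  the two distances by less than \<open>e / 2\<close>.\<close>

lemma capped_Hausdorff_dist_lift:
  assumes A: "A \<in> M1.CL" and B: "B \<in> M1.CL"
  shows "M2.capped_Hausdorff_dist (lift A) (lift B) = M1.capped_Hausdorff_dist A B"
proof -
  define h where "h y = \<bar>M2.setdist_pt y (lift A) - M2.setdist_pt y (lift B)\<bar>" for y
  have le: "ennreal (h y) \<le> M1.Hausdorff_dist A B" if y: "y \<in> M2" for y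
  proof (rule ennreal_le_epsilon)
    fix e :: real assume e: "e > 0"
    have "y \<in> M2.mtopology closure_of (f ` M1)"
      using y dense_image by simp
    then have "\<exists>z\<in>f ` M1. z \<in> M2.mball y (e / 2)"
      unfolding M2.metric_closure_of using e half_gt_zero by blast
    then obtain x where x: "x \<in> M1" "f x \<in> M2" "d2 y (f x) < e / 2"
      by auto
    have "h y \<le> h (f x) + e"
      using M2.setdist_pt_Lipschitz[OF y x(2) M2.CL_D(2,1)[OF lift_in_CL[OF A]]]
        M2.setdist_pt_Lipschitz[OF y x(2) M2.CL_D(2,1)[OF lift_in_CL[OF B]]]
        A B x unfolding h_def by linarith
    then have "ennreal (h y) \<le> ennreal (h (f x)) + ennreal e"
      using e by (simp add: h_def ennreal_leI flip: ennreal_plus)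
    also have "ennreal (h (f x)) \<le> M1.Hausdorff_dist A B"
      unfolding h_def M1.Hausdorff_dist_def
      using x(1) by (auto intro: SUP_upper simp: setdist_pt_lift A B)
    finally show "ennreal (h y) \<le> M1.Hausdorff_dist A B + ennreal e"
      by (simp add: add_right_mono)
  qed
  have "M2.Hausdorff_dist (lift A) (lift B) = M1.Hausdorff_dist A B"
  proof (rule antisym)
    show "M2.Hausdorff_dist (lift A) (lift B) \<le> M1.Hausdorff_dist A B"
      unfolding M2.Hausdorff_dist_def using le by (auto intro: SUP_least simp: h_def)
    show "M1.Hausdorff_dist A B \<le> M2.Hausdorff_dist (lift A) (lift B)"
      unfolding M1.Hausdorff_dist_def
    proof (rule SUP_least)
      fix x assume x: "x \<in> M1"
      then have "ennreal (h (f x)) \<le> M2.Hausdorff_dist (lift A) (lift B)"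
        unfolding M2.Hausdorff_dist_def h_def using maps_to by (intro SUP_upper) auto
      then show "ennreal \<bar>M1.setdist_pt x A - M1.setdist_pt x B\<bar> \<le> M2.Hausdorff_dist (lift A) (lift B)"
        by (simp add: h_def setdist_pt_lift A B x)
    qed
  qed
  then show ?thesis
    by (simp add: M1.capped_Hausdorff_dist_def M2.capped_Hausdorff_dist_def)
qed

lemma separable_space_codomain:
  assumes "separable_space M1.mtopology"
  shows "separable_space M2.mtopology"
proof -
  obtain C where C: "countable C" "C \<subseteq> M1" "M1.mtopology closure_of C = M1"
    using assms by (auto simp: separable_space_def)
  have "f ` M1 \<subseteq> M2.mtopology closure_of (f ` C)"
    using continuous_map_image_closure_subset[OF continuous_isometry, of C] C(3) by simp
  then have "M2 \<subseteq> M2.mtopology closure_of (f ` C)"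
    using closure_of_minimal[OF _ closedin_closure_of] dense_image by metis
  then have "M2.mtopology closure_of (f ` C) = M2"
    using closure_of_subset_topspace[of M2.mtopology "f ` C"] by simp
  then show ?thesis
    unfolding separable_space_def using C image_subset[of C]
    by (intro exI[of _ "f ` C"]) simp
qed

text \<open>A closed set with dense trace on the image of \<open>f\<close> is the closure of that trace, hence the lift
  of its preimage.\<close>

lemma lift_image_CL:
  "lift ` M1.CL = {B \<in> M2.CL. B \<subseteq> M2.mtopology closure_of (B \<inter> f ` M1)}"
proof (intro equalityI subsetI)
  fix B assume "B \<in> lift ` M1.CL"
  then obtain A where A: "A \<in> M1.CL" "B = lift A" by blast
  have "f ` A \<subseteq> lift A"
    unfolding lift_def by (rule closure_of_subset) (simp add: image_subset M1.CL_D(2)[OF A(1)])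
  then have "f ` A \<subseteq> lift A \<inter> f ` M1"
    using M1.CL_D(2)[OF A(1)] by blast
  then have "lift A \<subseteq> M2.mtopology closure_of (lift A \<inter> f ` M1)"
    using closure_of_mono unfolding lift_def by blast
  then show "B \<in> {B \<in> M2.CL. B \<subseteq> M2.mtopology closure_of (B \<inter> f ` M1)}"
    using A lift_in_CL by blast
next
  fix B assume "B \<in> {B \<in> M2.CL. B \<subseteq> M2.mtopology closure_of (B \<inter> f ` M1)}"
  then have B: "B \<in> M2.CL" "B \<subseteq> M2.mtopology closure_of (B \<inter> f ` M1)" by auto
  define A where "A = {x \<in> M1. f x \<in> B}"
  have fA: "f ` A = B \<inter> f ` M1" by (auto simp: A_def)
  have "lift A = B"
    unfolding lift_def fA
    using B(2) M2.CL_D(3)[OF B(1)] by (intro antisym closure_of_minimal) auto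
  moreover have "closedin M1.mtopology A"
    using closedin_continuous_map_preimage[OF continuous_isometry M2.CL_D(3)[OF B(1)]]
    by (simp add: A_def)
  moreover have "A \<noteq> {}"
    using \<open>lift A = B\<close> M2.CL_D(1)[OF B(1)] by (auto simp: lift_def)
  ultimately show "B \<in> lift ` M1.CL"
    by (auto simp: M1.CL_def)
qed

lemma Hausdorff_topology_homeomorphic:
  "M1.Hausdorff_topology homeomorphic_space
    subtopology M2.Hausdorff_topology {B \<in> M2.CL. B \<subseteq> M2.mtopology closure_of (B \<inter> f ` M1)}"
proof -
  interpret H: Metric_space12 M1.CL M1.capped_Hausdorff_dist M2.CL M2.capped_Hausdorff_dist
    by (simp add: Metric_space12_def M1.Metric_space_CL M2.Metric_space_CL)
  have "embedding_map M1.Hausdorff_topology M2.Hausdorff_topology lift"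
    using H.isometry_imp_embedding_map[of lift] lift_in_CL capped_Hausdorff_dist_lift
    by (simp add: M1.mtopology_capped_Hausdorff_dist M2.mtopology_capped_Hausdorff_dist)
  then show ?thesis
    using embedding_map_imp_homeomorphic_space lift_image_CL M1.topspace_Hausdorff_topology by metis
qed

end

section \<open>Complete metrizability of the hyperspace of a Polish space\<close>

theorem theorem1p2:
  fixes X :: "'a set" and d :: "'a \<Rightarrow> 'a \<Rightarrow> real"
  assumes "Metric_space X d"
    and "separable_space (Metric_space.mtopology X d)"
    and "completely_metrizable_space (Metric_space.mtopology X d)"
  shows "completely_metrizable_space (Metric_space.Hausdorff_topology X d)"
proof -
  interpret X: Metric_space X d by fact
  obtain f :: "['a,'a] \<Rightarrow> real" and m' where m': "mcomplete_of m'"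
    and f: "f \<in> X \<rightarrow> mspace m'" "mtopology_of m' closure_of f ` X = mspace m'"
      "\<And>x y. x \<in> X \<Longrightarrow> y \<in> X \<Longrightarrow> mdist m' (f x) (f y) = d x y"
    by (metis X.metric_completion)
  interpret Y: Metric_space "mspace m'" "mdist m'" by simp
  interpret dense_isometry X d "mspace m'" "mdist m'" f
    using f by unfold_locales (auto simp: mtopology_of_def)
  have comp: "Y.mcomplete" using m' by (simp add: mcomplete_of_def)
  have emb: "X.mtopology homeomorphic_space subtopology Y.mtopology (f ` X)"
    using embedding_map_imp_homeomorphic_space[OF isometry_imp_embedding_map[OF maps_to isometry]]
    by simp
  have "completely_metrizable_space (subtopology Y.mtopology (f ` X))"
    using emb assms(3) homeomorphic_completely_metrizable_space by blast
  \<comment> \<open>By Lavrentiev's theorem, completely metrizable subspaces are \<open>G\<^sub>\<delta>\<close>.\<close>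
  then have gdelta: "gdelta_in Y.mtopology (f ` X)"
    by (intro completely_metrizable_space_imp_gdelta_in Y.metrizable_space_mtopology)
      (use image_subset in auto)
  have "separable_space Y.mtopology"
    using assms(2) by (rule separable_space_codomain)
  then have "gdelta_in Y.Hausdorff_topology
      {B \<in> Y.CL. B \<subseteq> Y.mtopology closure_of (B \<inter> f ` X)}"
    using Y.gdelta_in_Hausdorff_dense_trace comp gdelta by blast
  moreover have "completely_metrizable_space Y.Hausdorff_topology"
    using Metric_space.completely_metrizable_space_mtopology[OF Y.Metric_space_CL
        Y.mcomplete_capped_Hausdorff_dist[OF comp]]
    by (simp add: Y.mtopology_capped_Hausdorff_dist)
  ultimately show ?thesis
    using completely_metrizable_space_gdelta_in Hausdorff_topology_homeomorphic
      homeomorphic_completely_metrizable_space by blast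
qed

end
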